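(* Let $n \in \mathbb{N}_0$. Then for all $z \in \mathbb{C}$ with $\max(1,2n) < \operatorname{Re}(z) < 2n+2$, $$\zeta(z) = \sin(\pi z/2)\, \pi^{z-1} \int_0^{\infty} s^{-z}\, [\coth(s) - \coth_n(s)] \, ds .$$ In particular, $$\zeta(3) = -\pi^2 \int_0^\infty s^{-3} [\coth (s) - \coth_1(s)]\, ds = -\pi^2 \int_0^\infty s^{-3} \Big[\coth (s) - \frac{1}{s} - \frac{s}{3}\Big]\, ds,$$ $$\zeta(5) = \pi^4 \int_0^\infty s^{-5} [\coth (s) - \coth_2(s)]\, ds = \pi^4 \int_0^\infty s^{-5} \Big[\coth (s) - \frac{1}{s} - \frac{s}{3} + \frac{s^3}{45}\Big]\, ds,$$ $$\zeta(7) = -\pi^6 \int_0^\infty s^{-7} [\coth (s) - \coth_3(s)]\, ds = -\pi^6 \int_0^\infty s^{-7} \Big[\coth (s) - \frac{1}{s} - \frac{s}{3} + \frac{s^3}{45} - \frac{2 s^5}{945}\Big]\, ds.$$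
   Context: $\mathbb{N} = \{1,2,3,\dots\}$, $\mathbb{N}_0 = \mathbb{N} \cup \{0\}$. $\zeta$ is the Riemann zeta function, $\zeta(z) = \sum_{k \in \mathbb{N}} k^{-z}$ for $\operatorname{Re}(z) > 1$. The functions $\coth_n$, for $z \in \mathbb{C} \setminus \{0\}$, are defined by $$\coth_0(z) = \frac{1}{z}, \qquad \coth_n(z) = \frac{1}{z} + \sum_{k=1}^n \frac{2^{2k} B_{2k}}{(2k)!} z^{2k-1}, \quad n \in \mathbb{N},$$ where $B_m$ are the Bernoulli numbers, generated by $\frac{w}{e^w-1} = \sum_{m \in \mathbb{N}_0} B_m \frac{w^m}{m!}$, $|w| < 2\pi$. Powers of positive numbers such as $s^{-z}$ and $\pi^{z-1}$ are defined by $x^{w} = e^{w \ln x}$ with the real logarithm. *)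

theory Defs
  imports "HOL-Complex_Analysis.Complex_Analysis"
begin

(* Only the half-plane Re z > 1 is meant: there the series converges absolutely and this is
   the Riemann zeta function; no analytic continuation is built in. *)
definition zeta :: "complex \<Rightarrow> complex" where
  "zeta z = (\<Sum>k. of_nat (Suc k) powr (- z))"

definition coth :: "complex \<Rightarrow> complex" where
  "coth z = cosh z / sinh z"

(* The convention is B_1 = -1/2; the analytic form of the generating function is
   bernoulli_sums below. The quotient is one of formal power series, where the common
   factor X is cancelled. *)
definition bernoulli :: "nat \<Rightarrow> complex" where
  "bernoulli m = fact m * fps_nth (fps_X / (fps_exp 1 - 1)) m"

definition coth_n :: "nat \<Rightarrow> complex \<Rightarrow> complex" where
  "coth_n n z = 1 / z +
     (\<Sum>k=1..n. 2 ^ (2 * k) * bernoulli (2 * k) / fact (2 * k) * z ^ (2 * k - 1))"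

lemma bernoulli_sums:
  fixes w :: complex
  assumes "norm w < 2 * pi" "w \<noteq> 0"
  shows "(\<lambda>m. bernoulli m * w ^ m / fact m) sums (w / (exp w - 1))"
proof -
  define F :: "complex fps" where "F = fps_X"
  define G :: "complex fps" where "G = fps_exp 1 - 1"
  have ev: "eval_fps G z = exp z - 1" for z
    by (simp add: G_def eval_fps_diff)
  have G1: "fps_nth G 0 = 0" "fps_nth G 1 = 1" by (simp_all add: G_def)
  hence subd: "subdegree G = 1"
    by (intro subdegreeI) (auto)
  have G0: "G \<noteq> 0" using G1 by auto
  have conv: "fps_conv_radius G = \<infinity>"
    using fps_conv_radius_diff[of "fps_exp 1 :: complex fps" 1] by (simp add: G_def)
  have nz: "eval_fps G z \<noteq> 0" if "z \<in> eball 0 (ereal (2 * pi))" "z \<noteq> 0" for z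
  proof
    assume "eval_fps G z = 0"
    hence "exp z = 1" by (simp add: ev)
    then obtain n :: int where n: "Re z = 0" "Im z = of_int (2 * n) * pi"
      by (auto simp: exp_eq_1)
    have "norm z = \<bar>Im z\<bar>" using n by (simp add: cmod_def)
    also have "\<dots> = 2 * \<bar>of_int n\<bar> * pi" using n by (simp add: abs_mult)
    finally have "norm z = 2 * \<bar>of_int n\<bar> * pi" .
    moreover have "norm z < 2 * pi" using that by simp
    ultimately have "\<bar>real_of_int n\<bar> < 1" by simp
    hence "n = 0" by linarith
    with n that show False by (simp add: complex_eq_iff)
  qed
  have *: "fps_conv_radius (F / G) \<ge> min (min (ereal (2*pi)) \<infinity>) \<infinity>"
    and **: "eval_fps (F / G) w = eval_fps F w / eval_fps G w"
    using fps_conv_radius_divide[of G F "2*pi"] eval_fps_divide[of G F "2*pi" w] nz assms subd G0 conv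
    by (auto simp: F_def)
  have "ereal (norm w) < fps_conv_radius (F / G)"
    by (rule less_le_trans[OF _ *]) (use assms in auto)
  hence "(\<lambda>m. fps_nth (F / G) m * w ^ m) sums eval_fps (F / G) w"
    by (rule sums_eval_fps)
  thus ?thesis
    by (simp add: ** ev bernoulli_def F_def[symmetric] G_def[symmetric])
       (simp add: F_def)
qed

end

theory Submission
  imports Defs
begin

text \<open>
  Write \<open>a\<^sub>k = \<pi>(k + 1)\<close> for \<open>k \<ge> 0\<close>. The poles of \<open>coth\<close> give the partial fraction expansion
  \<open>coth s = 1/s + \<Sum>\<^sub>k 2s / (s\<^sup>2 + a\<^sub>k\<^sup>2)\<close> (lemma \<open>coth_partial_fractions\<close>). Expanding each summand
  as a geometric series in \<open>s\<^sup>2 / a\<^sub>k\<^sup>2\<close> and stopping after \<open>n\<close> terms leaves an exact remainder, so that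
  \<open>coth s\<close> is an odd Laurent polynomial in \<open>s\<close> plus \<open>(-1)\<^sup>n \<Sum>\<^sub>k 2s\<^sup>2\<^sup>n\<^sup>+\<^sup>1 / (a\<^sub>k\<^sup>2\<^sup>n (s\<^sup>2 + a\<^sub>k\<^sup>2))\<close>.
  The generating function of the Bernoulli numbers forces this Laurent polynomial to be \<open>coth_n n\<close>,
  by uniqueness of asymptotic expansions at \<open>0\<close>; thus the displayed sum is \<open>coth s - coth_n n s\<close>
  for every \<open>s > 0\<close>, not only inside the disc where the Bernoulli series converges
  (lemma \<open>coth_minus_coth_n\<close>).

  Each summand has an elementary Mellin transform: substituting \<open>x = s\<^sup>2\<close> reduces it to
  \<open>\<integral> x\<^sup>w\<^sup>-\<^sup>1 / (x + c) dx = c\<^sup>w\<^sup>-\<^sup>1 \<pi> / sin (\<pi>w)\<close> with \<open>w = n + 1 - z/2\<close>, and the strip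
  \<open>2n < Re z < 2n + 2\<close> is exactly \<open>0 < Re w < 1\<close>. Since \<open>sin (\<pi>w) = (-1)\<^sup>n sin (\<pi>z/2)\<close>, the
  \<open>k\<close>-th summand contributes \<open>a\<^sub>k\<close> to the power \<open>-z\<close> times \<open>\<pi> / sin (\<pi>z/2)\<close>, with no
  dependence on \<open>n\<close> left. Summing over \<open>k\<close> yields \<open>\<zeta>(z)\<close>. The same computation at \<open>Re z\<close> evaluates
  the integrals of the absolute values, because all summands have the same sign, and \<open>Re z > 1\<close> makes
  their sum finite; this justifies exchanging sum and integral and proves integrability.
\<close>

section \<open>The partial fraction expansion of the hyperbolic cotangent\<close>

text \<open>
  This is the logarithmic derivative of Euler's product
  \<open>sinh w / w = \<Prod>\<^sub>k (1 + w\<^sup>2 / (\<pi>(k + 1))\<^sup>2)\<close>, which may be taken factor by factor because the product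
  converges uniformly on discs.
\<close>
lemma coth_partial_fractions:
  fixes w :: complex
  assumes "sinh w \<noteq> 0"
  shows "(\<lambda>k. 2 * w / (w ^ 2 + of_real (pi * Suc k) ^ 2)) sums (coth w - 1 / w)"
proof -
  have w: "w \<noteq> 0" using assms by auto
  define f :: "nat \<Rightarrow> complex \<Rightarrow> complex" where "f k x = 1 + x ^ 2 / of_real (pi * Suc k) ^ 2" for k x
  define R where "R = norm w + 1"
  define A where "A = ball (0::complex) R"
  have nz: "of_real (pi * Suc k) \<noteq> (0::complex)" for k
    unfolding of_real_eq_0_iff by simp
  have "uniformly_convergent_on (cball 0 R) (\<lambda>n x. \<Prod>k<n. f k x)"
  proof (rule uniformly_convergent_on_prod')
    show "continuous_on (cball 0 R) (f n)" for n
      unfolding f_def using nz by (intro continuous_intros) auto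
    show "uniformly_convergent_on (cball 0 R) (\<lambda>N x. \<Sum>n<N. norm (f n x - 1))"
    proof (rule Weierstrass_m_test')
      show "norm (norm (f n x - 1)) \<le> R ^ 2 / pi ^ 2 * (1 / real (n + 1) ^ 2)" if "x \<in> cball 0 R" for n x
      proof -
        have "norm x ^ 2 / (pi * Suc n) ^ 2 \<le> R ^ 2 / (pi * Suc n) ^ 2"
          using that by (intro divide_right_mono power_mono) auto
        thus ?thesis
          by (simp add: f_def norm_divide norm_mult norm_power power_mult_distrib del: of_nat_Suc)
      qed
      show "summable (\<lambda>n. R ^ 2 / pi ^ 2 * (1 / real (n + 1) ^ 2))"
        using inverse_squares_sums by (intro summable_mult) (simp add: sums_iff)
    qed
  qed simp
  then obtain P where "uniform_limit (cball 0 R) (\<lambda>n x. \<Prod>k<n. f k x) P sequentially"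
    unfolding uniformly_convergent_on_def by blast
  hence lim: "uniform_limit A (\<lambda>n x. \<Prod>k<n. f k x) P sequentially"
    by (rule uniform_limit_on_subset) (auto simp: A_def)
  \<comment> \<open>The locally uniform limit is identified by Euler's product for the sine at \<open>\<i>x/\<pi>\<close>;
    the origin is left out because \<open>sinh x / x\<close> has the value \<open>0\<close> there.\<close>
  have P: "P x = sinh x / x" if "x \<in> A" "x \<noteq> 0" for x
  proof -
    let ?z = "\<i> * x / of_real pi"
    have "(\<lambda>n. of_real pi * ?z * (\<Prod>k=1..n. 1 - ?z^2 / of_nat k^2)) \<longlonglongrightarrow> sin (of_real pi * ?z)"
      by (rule sin_product_formula_complex)
    also have "(\<lambda>n. \<Prod>k=1..n. 1 - ?z^2 / of_nat k^2) = (\<lambda>n. \<Prod>k<n. f k x)"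
    proof
      fix n
      have "(\<Prod>k=1..n. 1 - ?z^2 / of_nat k^2) = (\<Prod>k<n. 1 - ?z^2 / of_nat (Suc k)^2)"
        by (rule prod.reindex_bij_witness[of _ Suc "\<lambda>k. k - 1"]) auto
      also have "\<dots> = (\<Prod>k<n. f k x)"
        by (intro prod.cong) (auto simp: f_def field_simps simp del: of_nat_Suc)
      finally show "(\<Prod>k=1..n. 1 - ?z^2 / of_nat k^2) = (\<Prod>k<n. f k x)" .
    qed
    hence "(\<lambda>n. of_real pi * ?z * (\<Prod>k=1..n. 1 - ?z^2 / of_nat k^2)) =
           (\<lambda>n. of_real pi * ?z * (\<Prod>k<n. f k x))" by (simp only: fun_eq_iff) simp
    finally have "(\<lambda>n. \<i> * x * (\<Prod>k<n. f k x)) \<longlonglongrightarrow> sin (\<i> * x)" by simp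
    hence "(\<lambda>n. \<i> * x * (\<Prod>k<n. f k x) / (\<i> * x)) \<longlonglongrightarrow> sin (\<i> * x) / (\<i> * x)"
      using that by (intro tendsto_intros) auto
    hence "(\<lambda>n. (\<Prod>k<n. f k x)) \<longlonglongrightarrow> sinh x / x"
      using that by (simp add: sin_i_times sinh_field_def exp_minus)
    moreover have "(\<lambda>n. (\<Prod>k<n. f k x)) \<longlonglongrightarrow> P x"
      by (rule tendsto_uniform_limitI[OF lim that(1)])
    ultimately show ?thesis using LIMSEQ_unique by blast
  qed
  have wA: "w \<in> A" by (simp add: A_def R_def)
  have "(\<lambda>k. deriv (f k) w / f k w) sums (deriv P w / P w)"
    by (rule logderiv_prodinf_complex_uniform_limit[OF lim])
       (use nz P wA w assms in \<open>auto simp: A_def f_def intro!: holomorphic_intros\<close>)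
  moreover have "deriv (f k) w / f k w = 2 * w / (w ^ 2 + of_real (pi * Suc k) ^ 2)" for k
  proof -
    define c where "c = complex_of_real (pi * Suc k) ^ 2"
    have c: "c \<noteq> 0" using nz[of k] by (simp add: c_def del: of_nat_Suc)
    have "deriv (f k) w = 2 * w / c"
      unfolding f_def c_def[symmetric] using c
      by (intro DERIV_imp_deriv) (auto intro!: derivative_eq_intros)
    thus ?thesis unfolding f_def c_def[symmetric] using c by (simp add: field_simps)
  qed
  moreover have "deriv P w / P w = coth w - 1 / w"
  proof -
    have "eventually (\<lambda>x. x \<in> A - {0}) (nhds w)"
      using wA w by (intro eventually_nhds_in_open) (auto simp: A_def)
    hence "eventually (\<lambda>x. P x = sinh x / x) (nhds w)"
      by eventually_elim (use P in auto)
    hence "deriv P w = deriv (\<lambda>x. sinh x / x) w"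
      by (rule deriv_cong_ev) auto
    also have "\<dots> = (cosh w * w - sinh w) / (w * w)"
      using w by (intro DERIV_imp_deriv) (auto intro!: derivative_eq_intros)
    finally show ?thesis
      unfolding P[OF wA w] using assms w by (simp add: coth_def field_simps)
  qed
  ultimately show ?thesis by simp
qed

section \<open>The Mellin transform of a simple fraction\<close>

text \<open>
  The change of variables theorem concerns the completed measure; continuity transfers it to
  Borel-Lebesgue integrals.
\<close>
lemma set_integral_substitution_Ioi:
  fixes f :: "real \<Rightarrow> complex" and g h :: "real \<Rightarrow> real"
  assumes g: "bij_betw g {0<..} {0<..}"
    and der: "\<And>x. x > 0 \<Longrightarrow> (g has_field_derivative h x) (at x)"
    and h: "continuous_on {0<..} h" "\<And>x. x > 0 \<Longrightarrow> h x \<ge> 0"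
    and f: "continuous_on {0<..} f" "set_integrable lborel {0<..} f"
  shows "set_integrable lborel {0<..} (\<lambda>x. h x *\<^sub>R f (g x))"
    and "(LBINT x:{0<..}. h x *\<^sub>R f (g x)) = (LBINT x:{0<..}. f x)"
proof -
  have im: "g ` {0<..} = {0<..}" and inj: "inj_on g {0<..}"
    using g by (auto simp: bij_betw_def)
  have cg: "continuous_on {0<..} g"
    using der by (intro continuous_at_imp_continuous_on) (auto intro: DERIV_isCont)
  have meas: "(\<lambda>x. indicator {0<..} x *\<^sub>R F x) \<in> borel_measurable lborel"
    if "continuous_on {0<..} F" for F :: "real \<Rightarrow> complex"
    using that by (auto intro!: borel_measurable_continuous_on_indicator)
  have leb: "F absolutely_integrable_on {0<..} \<longleftrightarrow> set_integrable lborel {0<..} F"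
    if "continuous_on {0<..} F" for F :: "real \<Rightarrow> complex"
    unfolding set_integrable_def using meas[OF that] by (intro integrable_completion) simp
  have "continuous_on {0<..} (\<lambda>x. f (g x))"
    by (rule continuous_on_compose2[OF f(1) cg]) (use im in auto)
  hence c: "continuous_on {0<..} (\<lambda>x. h x *\<^sub>R f (g x))"
    by (intro continuous_intros h)
  have "(\<lambda>x. \<bar>h x\<bar> *\<^sub>R f (g x)) absolutely_integrable_on {0<..} \<and>
        integral {0<..} (\<lambda>x. \<bar>h x\<bar> *\<^sub>R f (g x)) = integral {0<..} f
          \<longleftrightarrow> f absolutely_integrable_on g ` {0<..} \<and> integral (g ` {0<..}) f = integral {0<..} f"
    using der inj by (intro has_absolute_integral_change_of_variables_real)
                     (auto intro: has_field_derivative_at_within)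
  moreover have "(\<lambda>x. \<bar>h x\<bar> *\<^sub>R f (g x)) absolutely_integrable_on {0<..} \<longleftrightarrow>
                 (\<lambda>x. h x *\<^sub>R f (g x)) absolutely_integrable_on {0<..}"
    by (intro set_integrable_cong) (use h in auto)
  moreover have "integral {0<..} (\<lambda>x. \<bar>h x\<bar> *\<^sub>R f (g x)) = integral {0<..} (\<lambda>x. h x *\<^sub>R f (g x))"
    by (intro Henstock_Kurzweil_Integration.integral_cong) (use h in auto)
  ultimately have "(\<lambda>x. h x *\<^sub>R f (g x)) absolutely_integrable_on {0<..}"
    and I: "integral {0<..} (\<lambda>x. h x *\<^sub>R f (g x)) = integral {0<..} f"
    using f leb[OF f(1)] im by auto
  thus *: "set_integrable lborel {0<..} (\<lambda>x. h x *\<^sub>R f (g x))"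
    using leb[OF c] by simp
  show "(LBINT x:{0<..}. h x *\<^sub>R f (g x)) = (LBINT x:{0<..}. f x)"
    using set_borel_integral_eq_integral(2)[OF *] set_borel_integral_eq_integral(2)[OF f(2)] I
    by simp
qed

lemma Gamma_integral_scaled:
  fixes w :: complex and t :: real
  assumes w: "Re w > 0" and t: "t > 0"
  shows "set_integrable lborel {0<..} (\<lambda>x. of_real x powr (w - 1) * of_real (exp (- (t * x))))"
    and "(LBINT x:{0<..}. of_real x powr (w - 1) * of_real (exp (- (t * x)))) =
           Gamma w * of_real t powr (- w)"
proof -
  define f where "f = (\<lambda>x. complex_of_real x powr (w - 1) * of_real (exp (- x)))"
  define g where "g = (\<lambda>x. complex_of_real x powr (w - 1) * of_real (exp (- (t * x))))"
  have cf: "continuous_on {0<..} f"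
    unfolding f_def by (auto intro!: continuous_intros)
  have Gam: "f absolutely_integrable_on {0<..}" "(f has_integral Gamma w) {0<..}"
    using absolutely_integrable_Gamma_integral'[OF w] Gamma_integral_complex'[OF w]
    by (simp_all add: f_def exp_minus field_simps)
  have f: "set_integrable lborel {0<..} f"
    using Gam(1) cf unfolding set_integrable_def
    by (subst (asm) integrable_completion) (auto intro!: borel_measurable_continuous_on_indicator)
  have If: "(LBINT x:{0<..}. f x) = Gamma w"
    using set_borel_integral_eq_integral(2)[OF f] Gam(2) by (simp add: integral_unique)
  have "bij_betw (\<lambda>x. t * x) {0<..} {0<..}"
    by (rule bij_betw_byWitness[of _ "\<lambda>x. x / t"]) (use t in auto)
  note sub = set_integral_substitution_Ioi[where f = f, OF this _ _ _ cf f, of "\<lambda>_. t"]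
  have eq: "t *\<^sub>R f (t * x) = of_real t powr w * g x" if "x > 0" for x
    using that t by (simp add: f_def g_def powr_times_real powr_diff scaleR_conv_of_real)
  have "set_integrable lborel {0<..} (\<lambda>x. t *\<^sub>R f (t * x))"
    by (rule sub) (use t in \<open>auto intro!: derivative_eq_intros continuous_intros\<close>)
  also have "?this \<longleftrightarrow> set_integrable lborel {0<..} (\<lambda>x. of_real t powr w * g x)"
    by (intro set_integrable_cong) (auto simp: eq)
  finally have *: "set_integrable lborel {0<..} (\<lambda>x. of_real t powr w * g x)" .
  have "(LBINT x:{0<..}. t *\<^sub>R f (t * x)) = Gamma w"
    unfolding If[symmetric]
    by (rule sub) (use t in \<open>auto intro!: derivative_eq_intros continuous_intros\<close>)
  also have "(LBINT x:{0<..}. t *\<^sub>R f (t * x)) = (LBINT x:{0<..}. of_real t powr w * g x)"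
    by (intro set_lebesgue_integral_cong) (auto simp: eq)
  finally have "of_real t powr w * (LBINT x:{0<..}. g x) = Gamma w" by simp
  thus "(LBINT x:{0<..}. g x) = Gamma w * of_real t powr (- w)"
    using t by (simp add: powr_minus field_simps)
  show "set_integrable lborel {0<..} g"
    using * t by simp
qed

lemma Gamma_integral_scaled_norm:
  fixes w :: complex and t :: real
  assumes w: "Re w > 0" and t: "t > 0"
  shows "(LBINT x:{0<..}. norm (complex_of_real x powr (w - 1) * of_real (exp (- (t * x))))) =
           Gamma (Re w) * t powr (- Re w)"
proof -
  have "complex_of_real (LBINT x:{0<..}. norm (complex_of_real x powr (w - 1) * of_real (exp (- (t * x))))) =
        (LBINT x:{0<..}. complex_of_real (norm (complex_of_real x powr (w - 1) * of_real (exp (- (t * x))))))"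
    by (rule set_integral_complex_of_real[symmetric])
  also have "\<dots> = (LBINT x:{0<..}. of_real x powr (of_real (Re w) - 1) * of_real (exp (- (t * x))))"
    by (intro set_lebesgue_integral_cong)
       (auto simp: norm_mult norm_powr_real_powr powr_of_real[symmetric])
  also have "\<dots> = of_real (Gamma (Re w) * t powr (- Re w))"
    using Gamma_integral_scaled(2)[of "of_real (Re w)" t] w t
    by (simp add: Gamma_complex_of_real powr_of_real[symmetric])
  finally show ?thesis unfolding of_real_eq_iff .
qed

text \<open>
  Writing \<open>1 / (x + c)\<close> as \<open>\<integral> exp (-t(x + c)) dt\<close> and integrating over \<open>x\<close> first turns the
  integral into \<open>\<Gamma>(w) \<Gamma>(1 - w)\<close> times a power of \<open>c\<close>, and the reflection formula applies. The condition on
  \<open>Re w\<close> makes both Gamma integrals converge absolutely, which is what Fubini's theorem requires.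
\<close>
lemma Mellin_transform_of_inverse_shift:
  fixes w :: complex and c :: real
  assumes w: "0 < Re w" "Re w < 1" and c: "c > 0"
  shows "set_integrable lborel {0<..} (\<lambda>x. of_real x powr (w - 1) / of_real (x + c))"
    and "(LBINT x:{0<..}. of_real x powr (w - 1) / of_real (x + c)) =
           of_real c powr (w - 1) * (of_real pi / sin (of_real pi * w))"
proof -
  define G where "G = (\<lambda>t x. complex_of_real x powr (w - 1) * of_real (exp (- (t * x))))"
  define E where "E = (\<lambda>t. indicator {0<..} t *\<^sub>R exp (- (c * t)))"
  define F where "F = (\<lambda>(t, x). E t *\<^sub>R (indicator {0<..} x *\<^sub>R G t x))"
  \<comment> \<open>The trivial factor \<open>t powr (1 - 1)\<close> exhibits the integral over \<open>t\<close> as a Gamma integral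
    with parameter \<open>1\<close>.\<close>
  have Fx: "F (t, x) = indicator {0<..} x *\<^sub>R of_real x powr (w - 1) *
              (indicator {0<..} t *\<^sub>R of_real t powr (1 - 1) * of_real (exp (- ((x + c) * t))))" for t x
    by (auto simp: F_def E_def G_def indicator_def scaleR_conv_of_real algebra_simps simp flip: exp_add of_real_mult)
  have meas: "F \<in> borel_measurable (lborel \<Otimes>\<^sub>M lborel)"
  proof -
    have [measurable]: "(\<lambda>x. indicator {0<..} x *\<^sub>R complex_of_real x powr (w - 1)) \<in> borel_measurable borel"
      by (auto intro!: borel_measurable_continuous_on_indicator continuous_intros)
    have "(\<lambda>(t, x). E t *\<^sub>R ((indicator {0<..} x *\<^sub>R complex_of_real x powr (w - 1)) *
             of_real (exp (- (t * x))))) \<in> borel_measurable (lborel \<Otimes>\<^sub>M lborel)"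
      unfolding E_def by measurable
    thus ?thesis by (simp add: F_def G_def)
  qed
  have E: "E t \<noteq> 0 \<Longrightarrow> t > 0" "E t \<ge> 0" for t
    by (auto simp: E_def indicator_def split: if_splits)
  have intF: "integrable (lborel \<Otimes>\<^sub>M lborel) F"
  proof (rule lborel_pair.Fubini_integrable[OF meas])
    show "AE t in lborel. integrable lborel (\<lambda>x. F (t, x))"
    proof (rule AE_I2)
      fix t
      show "integrable lborel (\<lambda>x. F (t, x))"
      proof (cases "t > 0")
        case True
        thus ?thesis using Gamma_integral_scaled(1)[OF w(1) True]
          unfolding F_def G_def set_integrable_def by (simp del: scaleR_scaleR)
      qed (auto simp: F_def E_def)
    qed
    have "(\<integral>x. norm (F (t, x)) \<partial>lborel) =
            indicator {0<..} t *\<^sub>R (Gamma (Re w) * (t powr (- Re w) * exp (- (c * t))))" for t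
    proof (cases "t > 0")
      case True
      have "(\<integral>x. norm (F (t, x)) \<partial>lborel) = (\<integral>x. E t * (indicator {0<..} x *\<^sub>R norm (G t x)) \<partial>lborel)"
        by (intro Bochner_Integration.integral_cong) (auto simp: F_def E_def)
      also have "\<dots> = E t * (Gamma (Re w) * t powr (- Re w))"
        using Gamma_integral_scaled_norm[OF w(1) True]
        by (simp add: set_lebesgue_integral_def G_def)
      finally show ?thesis using True by (simp add: E_def)
    qed (auto simp: F_def E_def)
    moreover have "set_integrable lborel {0<..} (\<lambda>t. norm (complex_of_real t powr ((1 - of_real (Re w)) - 1) * of_real (exp (- (c * t)))))"
      using w c by (intro set_integrable_norm Gamma_integral_scaled) auto
    hence "set_integrable lborel {0<..} (\<lambda>t. t powr (- Re w) * exp (- (c * t)))"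
      by (subst (asm) set_integrable_cong[OF refl refl]) (auto simp: norm_mult norm_powr_real_powr)
    hence "set_integrable lborel {0<..} (\<lambda>t. Gamma (Re w) * (t powr (- Re w) * exp (- (c * t))))"
      by simp
    ultimately show "integrable lborel (\<lambda>t. \<integral>x. norm (F (t, x)) \<partial>lborel)"
      by (simp add: set_integrable_def)
  qed
  have inner_t: "(\<integral>t. F (t, x) \<partial>lborel) = indicator {0<..} x *\<^sub>R (of_real x powr (w - 1) / of_real (x + c))" for x
  proof (cases "x > 0")
    case True
    have "(\<integral>t. F (t, x) \<partial>lborel) = of_real x powr (w - 1) * (\<integral>t. (indicator {0<..} t *\<^sub>R of_real t powr (1 - 1) * of_real (exp (- ((x + c) * t)))) \<partial>lborel)"
      unfolding Fx using True by (simp only: integral_mult_right_zero) simp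
    also have "\<dots> = of_real x powr (w - 1) / of_real (x + c)"
      using Gamma_integral_scaled(2)[of 1 "x + c"] True c
      by (simp add: set_lebesgue_integral_def powr_minus field_simps)
    finally show ?thesis using True by simp
  qed (simp add: F_def)
  have inner_x: "(\<integral>x. F (t, x) \<partial>lborel) = Gamma w * (indicator {0<..} t *\<^sub>R (of_real t powr ((1 - w) - 1) * of_real (exp (- (c * t)))))" for t
  proof (cases "t > 0")
    case True
    have "(\<integral>x. F (t, x) \<partial>lborel) = E t *\<^sub>R (LBINT x:{0<..}. G t x)"
      by (simp add: F_def set_lebesgue_integral_def del: scaleR_scaleR)
    also have "\<dots> = E t *\<^sub>R (Gamma w * of_real t powr (- w))"
      using Gamma_integral_scaled(2)[OF w(1) True] by (simp add: G_def)
    finally show ?thesis using True by (simp add: E_def scaleR_conv_of_real)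
  qed (auto simp: F_def E_def)
  show "set_integrable lborel {0<..} (\<lambda>x. of_real x powr (w - 1) / of_real (x + c))"
    using lborel_pair.integrable_snd[of "\<lambda>t x. F (t, x)"] intF unfolding set_integrable_def inner_t by simp
  have "(LBINT x:{0<..}. of_real x powr (w - 1) / of_real (x + c)) = (\<integral>x. (\<integral>t. F (t, x) \<partial>lborel) \<partial>lborel)"
    unfolding inner_t set_lebesgue_integral_def ..
  also have "\<dots> = (\<integral>t. (\<integral>x. F (t, x) \<partial>lborel) \<partial>lborel)"
    using lborel_pair.Fubini_integral[of "\<lambda>t x. F (t, x)"] intF by simp
  also have "\<dots> = Gamma w * (LBINT t:{0<..}. of_real t powr ((1 - w) - 1) * of_real (exp (- (c * t))))"
    unfolding inner_x set_lebesgue_integral_def by (rule integral_mult_right_zero)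
  also have "\<dots> = Gamma w * (Gamma (1 - w) * of_real c powr (- (1 - w)))"
    using w c by (subst Gamma_integral_scaled) auto
  also have "\<dots> = of_real c powr (w - 1) * (Gamma w * Gamma (1 - w))" by simp
  also have "Gamma w * Gamma (1 - w) = of_real pi / sin (of_real pi * w)"
    by (rule Gamma_reflection_complex)
  finally show "(LBINT x:{0<..}. of_real x powr (w - 1) / of_real (x + c)) =
           of_real c powr (w - 1) * (of_real pi / sin (of_real pi * w))" .
qed

section \<open>Expansion of the hyperbolic cotangent at the origin\<close>

text \<open>
  Averaging the generating function of the Bernoulli numbers at \<open>2w\<close> and \<open>-2w\<close> removes the terms of odd
  index and turns \<open>2w / (exp (2w) - 1)\<close> into \<open>w coth w\<close>. The nearest singularities, at
  \<open>\<plusminus>\<i>\<pi>\<close>, give the radius of convergence.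
\<close>
lemma coth_power_series:
  fixes w :: complex
  assumes w: "w \<noteq> 0" "norm w < pi"
  shows "(\<lambda>k. 2 ^ (2 * k) * bernoulli (2 * k) / fact (2 * k) * (w ^ 2) ^ k) sums (w * coth w)"
proof -
  \<comment> \<open>The zeros of \<open>exp (2w) - 1\<close> are the integer multiples of \<open>\<i>\<pi>\<close>.\<close>
  have nz: "exp (2 * w) \<noteq> 1"
  proof
    assume "exp (2 * w) = 1"
    then obtain n :: int where n: "Re w = 0" "2 * Im w = of_int (2 * n) * pi"
      by (auto simp: exp_eq_1)
    have "norm w = \<bar>of_int n\<bar> * pi" using n by (simp add: cmod_def abs_mult)
    with w have "\<bar>real_of_int n\<bar> < 1" by simp
    hence "n = 0" by linarith
    with n w show False by (simp add: complex_eq_iff)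
  qed
  define f where "f m = (if even m then bernoulli m * (2 * w) ^ m / fact m else 0)" for m
  have "(\<lambda>m. (bernoulli m * (2 * w) ^ m / fact m + bernoulli m * (- (2 * w)) ^ m / fact m) / 2)
          sums ((2 * w / (exp (2 * w) - 1) + - (2 * w) / (exp (- (2 * w)) - 1)) / 2)"
    using w by (intro sums_divide sums_add bernoulli_sums) (auto simp: norm_mult)
  also have "(\<lambda>m. (bernoulli m * (2 * w) ^ m / fact m + bernoulli m * (- (2 * w)) ^ m / fact m) / 2) = f"
    by (auto simp: f_def fun_eq_iff)
  also have "(2 * w / (exp (2 * w) - 1) + - (2 * w) / (exp (- (2 * w)) - 1)) / 2 = w * coth w"
  proof -
    define e where "e = exp w"
    have e: "e \<noteq> 0" "e ^ 2 \<noteq> 1" using nz by (auto simp: e_def exp_double)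
    have "(2 * w / (e ^ 2 - 1) + - (2 * w) / (inverse (e ^ 2) - 1)) / 2 = w * ((e + inverse e) / (e - inverse e))"
    proof -
      have 1: "inverse (e ^ 2) - 1 = - (e ^ 2 - 1) / e ^ 2"
       and 2: "(e + inverse e) / (e - inverse e) = (e ^ 2 + 1) / (e ^ 2 - 1)"
        using e by (auto simp: divide_simps power2_eq_square)
      have "e ^ 2 - 1 \<noteq> 0" using e by simp
      thus ?thesis unfolding 1 2 using e by (simp add: divide_simps) (simp add: algebra_simps)
    qed
    moreover have "(a / 2) / (b / 2) = a / b" for a b :: complex by simp
    hence "coth w = (e + inverse e) / (e - inverse e)"
      unfolding coth_def cosh_field_def sinh_field_def exp_minus e_def by this
    ultimately show ?thesis
      by (simp only: exp_double exp_minus e_def)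
  qed
  finally have "f sums (w * coth w)" .
  hence "(\<lambda>k. f (2 * k)) sums (w * coth w)"
    by (subst sums_mono_reindex) (auto simp: strict_mono_def f_def elim!: evenE)
  thus ?thesis
    by (simp add: f_def power_mult_distrib flip: power_mult) (simp add: mult_ac)
qed

text \<open>
  Up to the factor \<open>s\<^sup>2\<^sup>n\<^sup>+\<^sup>1\<close>, this is the remainder at \<open>x = s\<^sup>2\<close> of the partial fraction series of \<open>coth\<close>
  after \<open>n\<close> steps of geometric expansion in each summand. Its value at \<open>0\<close> is the next
  expansion coefficient \<open>2 (-1)\<^sup>n \<zeta>(2n + 2) / \<pi>\<^sup>2\<^sup>n\<^sup>+\<^sup>2\<close>.
\<close>
definition coth_tail :: "nat \<Rightarrow> real \<Rightarrow> real" where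
  "coth_tail n x = (\<Sum>k. (-1) ^ n * 2 / ((pi * Suc k) ^ (2 * n) * (x + (pi * Suc k) ^ 2)))"

text \<open>
  The bound is uniform in \<open>n\<close> and \<open>x\<close>: since \<open>\<pi>\<close> exceeds \<open>2\<close>, the power \<open>(\<pi>(k + 1))\<^sup>2\<^sup>n\<close> is at least \<open>1\<close>
  and \<open>\<pi>\<^sup>2\<close> absorbs the factor \<open>2\<close>.
\<close>
lemma coth_tail_bound:
  assumes "x \<ge> 0"
  shows "norm ((-1) ^ n * 2 / ((pi * Suc k) ^ (2 * n) * (x + (pi * Suc k) ^ 2))) \<le> 1 / real (k + 1) ^ 2"
proof -
  have "1 * 1 \<le> pi * Suc k" using pi_gt3 by (intro mult_mono) auto
  hence 1: "1 \<le> (pi * Suc k) ^ (2 * n)" by (intro one_le_power) simp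
  have "2 * real (k + 1) ^ 2 \<le> pi ^ 2 * real (k + 1) ^ 2"
    using pi_gt3 power_mono[of 2 pi 2] by (intro mult_right_mono) auto
  also have "\<dots> \<le> 1 * (x + (pi * Suc k) ^ 2)" using assms by (simp add: power_mult_distrib)
  also have "\<dots> \<le> (pi * Suc k) ^ (2 * n) * (x + (pi * Suc k) ^ 2)"
    using 1 assms by (intro mult_right_mono) auto
  finally have 2: "2 * real (k + 1) ^ 2 \<le> (pi * Suc k) ^ (2 * n) * (x + (pi * Suc k) ^ 2)" .
  have 3: "0 < 2 * real (k + 1) ^ 2" by simp
  have "2 / ((pi * Suc k) ^ (2 * n) * (x + (pi * Suc k) ^ 2)) \<le> 2 / (2 * real (k + 1) ^ 2)"
    by (rule divide_left_mono[OF 2 _ mult_pos_pos[OF less_le_trans[OF 3 2] 3]]) simp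
  moreover have "0 \<le> (pi * Suc k) ^ (2 * n) * (x + (pi * Suc k) ^ 2)"
    by (rule order_trans[OF _ 2]) simp
  moreover have "norm ((-1) ^ n * 2 / D) = 2 / D" if "D \<ge> 0" for D :: real
    using that by (simp add: abs_mult power_abs)
  ultimately show ?thesis by (simp only: Suc_eq_plus1 mult_1)
qed

lemma summable_inverse_squares: "summable (\<lambda>k. 1 / real (k + 1) ^ 2)"
  using inverse_squares_sums by (simp add: sums_iff)

lemma coth_tail_sums:
  assumes "x \<ge> 0"
  shows "(\<lambda>k. (-1) ^ n * 2 / ((pi * Suc k) ^ (2 * n) * (x + (pi * Suc k) ^ 2))) sums coth_tail n x"
  unfolding coth_tail_def
  by (rule summable_sums[OF summable_comparison_test'[OF summable_inverse_squares]])
     (rule coth_tail_bound[OF assms])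

lemma abs_coth_tail_le:
  assumes "x \<ge> 0"
  shows "\<bar>coth_tail n x\<bar> \<le> pi ^ 2 / 6"
proof -
  have "norm (coth_tail n x) \<le> (\<Sum>k. 1 / real (k + 1) ^ 2)"
    unfolding coth_tail_def
    by (rule norm_suminf_le[OF coth_tail_bound[OF assms] summable_inverse_squares])
  also have "\<dots> = pi ^ 2 / 6" using inverse_squares_sums by (simp add: sums_iff)
  finally show ?thesis by simp
qed

text \<open>
  One step of geometric expansion, \<open>1 / (x + a\<^sup>2) = 1 / a\<^sup>2 - x / (a\<^sup>2 (x + a\<^sup>2))\<close>, in every summand.
\<close>
lemma coth_tail_Suc:
  assumes "x \<ge> 0"
  shows "coth_tail n x = coth_tail n 0 + x * coth_tail (Suc n) x"
proof -
  have sums: "(\<lambda>k. (-1) ^ n * 2 / ((pi * Suc k) ^ (2 * n) * (0 + (pi * Suc k) ^ 2)) +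
             x * ((-1) ^ Suc n * 2 / ((pi * Suc k) ^ (2 * Suc n) * (x + (pi * Suc k) ^ 2))))
         sums (coth_tail n 0 + x * coth_tail (Suc n) x)"
    using assms by (intro sums_add sums_mult coth_tail_sums) auto
  have "(-1) ^ n * 2 / (a ^ (2 * n) * (0 + a ^ 2)) +
             x * ((-1) ^ Suc n * 2 / (a ^ (2 * Suc n) * (x + a ^ 2))) =
             (-1) ^ n * 2 / (a ^ (2 * n) * (x + a ^ 2))" if "a > 0" for a :: real
  proof -
    have nz: "x + a ^ 2 \<noteq> 0" "a \<noteq> 0" using assms that
      by (metis add_nonneg_pos less_irrefl zero_less_power, simp)
    define p where "p = (-1) ^ n * 2 / a ^ (2 * n)"
    have "p / a ^ 2 - x * p / (a ^ 2 * (x + a ^ 2)) = p / (x + a ^ 2)"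
      using nz by (simp add: divide_simps) (simp add: algebra_simps)
    moreover have "(-1) ^ n * 2 / (a ^ (2 * n) * (0 + a ^ 2)) = p / a ^ 2"
      by (simp add: p_def)
    moreover have "x * ((-1) ^ Suc n * 2 / (a ^ (2 * Suc n) * (x + a ^ 2))) = - (x * p / (a ^ 2 * (x + a ^ 2)))"
      by (simp add: p_def power_add power2_eq_square mult_ac)
    moreover have "(-1) ^ n * 2 / (a ^ (2 * n) * (x + a ^ 2)) = p / (x + a ^ 2)"
      by (simp add: p_def)
    ultimately show ?thesis by (simp only:)
  qed
  hence eq: "(\<lambda>k. (-1) ^ n * 2 / ((pi * Suc k) ^ (2 * n) * (0 + (pi * Suc k) ^ 2)) +
             x * ((-1) ^ Suc n * 2 / ((pi * Suc k) ^ (2 * Suc n) * (x + (pi * Suc k) ^ 2)))) =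
         (\<lambda>k. (-1) ^ n * 2 / ((pi * Suc k) ^ (2 * n) * (x + (pi * Suc k) ^ 2)))"
    by (simp del: of_nat_Suc power_Suc mult_Suc_right)
  from sums_unique2[OF coth_tail_sums[OF assms] sums[unfolded eq]] show ?thesis .
qed

lemma coth_eq_coth_tail:
  assumes "s > 0"
  shows "coth (of_real s) = 1 / of_real s + of_real (s * coth_tail 0 (s ^ 2))"
proof -
  have "sinh s \<noteq> 0" using assms by simp
  hence "sinh (of_real s :: complex) \<noteq> 0"
    by (simp add: sinh_field_def exp_of_real flip: of_real_minus)
  note sums = coth_partial_fractions[OF this]
  have "(\<lambda>k. complex_of_real (s * ((-1) ^ 0 * 2 / ((pi * Suc k) ^ (2 * 0) * (s ^ 2 + (pi * Suc k) ^ 2))))) sums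
                   of_real (s * coth_tail 0 (s ^ 2))"
    by (intro sums_of_real sums_mult coth_tail_sums) simp
  also have "(\<lambda>k. complex_of_real (s * ((-1) ^ 0 * 2 / ((pi * Suc k) ^ (2 * 0) * (s ^ 2 + (pi * Suc k) ^ 2))))) =
     (\<lambda>k. 2 * of_real s / (of_real s ^ 2 + of_real (pi * Suc k) ^ 2))"
    by (simp add: mult_ac)
  finally have "coth (of_real s) - 1 / of_real s = complex_of_real (s * coth_tail 0 (s ^ 2))"
    by (rule sums_unique2[OF sums])
  thus ?thesis by (simp add: algebra_simps)
qed

definition coth_coeff :: "nat \<Rightarrow> complex" where
  "coth_coeff k = 2 ^ (2 * k) * bernoulli (2 * k) / fact (2 * k)"

text \<open>
  These are the coefficients of the identity \<open>(X / (exp X - 1)) (exp X - 1) = X\<close> at the positive powers of \<open>X\<close>.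
\<close>
lemma bernoulli_recurrence:
  "(\<Sum>i\<le>m. bernoulli i / (fact i * fact (Suc m - i))) = (if m = 0 then 1 else 0)"
proof -
  define F where "F = fps_X / (fps_exp 1 - 1 :: complex fps)"
  define G where "G = (fps_exp 1 - 1 :: complex fps)"
  have G: "fps_nth G 0 = 0" "fps_nth G 1 = 1" by (simp_all add: G_def)
  hence subd: "subdegree G = 1" by (intro subdegreeI) auto
  have "G \<noteq> 0" using G by auto
  hence "G dvd fps_X" using subd by (subst fps_dvd_iff) auto
  hence "fps_nth (F * G) (Suc m) = fps_nth fps_X (Suc m)"
    by (simp add: F_def flip: G_def)
  also have "fps_nth (F * G) (Suc m) = (\<Sum>i=0..Suc m. fps_nth F i * fps_nth G (Suc m - i))"
    by (rule fps_mult_nth)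
  also have "\<dots> = (\<Sum>i\<le>m. fps_nth F i * fps_nth G (Suc m - i))"
    using G by (simp add: atMost_atLeast0)
  also have "\<dots> = (\<Sum>i\<le>m. bernoulli i / (fact i * fact (Suc m - i)))"
    by (intro sum.cong) (auto simp: bernoulli_def F_def G_def)
  finally show ?thesis by simp
qed

lemma bernoulli_values:
  "bernoulli 0 = 1" "bernoulli 2 = 1 / 6" "bernoulli 4 = - 1 / 30" "bernoulli 6 = 1 / 42"
proof -
  note rec = bernoulli_recurrence
  have b0: "bernoulli 0 = 1" using rec[of 0] by simp
  have b1: "bernoulli (Suc 0) = - 1 / 2" using rec[of 1] b0 by (simp add: add_eq_0_iff)
  have "bernoulli 2 / fact 2 = 1 / 6 / fact 2"
    using rec[of 2] by (simp add: atMost_nat_numeral atMost_Suc fact_numeral add_eq_0_iff add_eq_0_iff2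
        b0 b1)
  hence b2: "bernoulli 2 = 1 / 6" by (simp only: divide_cancel_right fact_nonzero simp_thms)
  have "bernoulli 3 / fact 3 = 0 / fact 3"
    using rec[of 3] by (simp add: atMost_nat_numeral atMost_Suc fact_numeral add_eq_0_iff add_eq_0_iff2
        b0 b1 b2)
  hence b3: "bernoulli 3 = 0" by (simp only: divide_cancel_right fact_nonzero simp_thms)
  have "30 * bernoulli 4 + 1 = 0"
    using rec[of 4] by (simp add: atMost_nat_numeral atMost_Suc fact_numeral add_eq_0_iff add_eq_0_iff2
        b0 b1 b2 b3)
  hence "bernoulli 4 = (- 1) / 30" by (subst eq_divide_eq) (simp add: eq_neg_iff_add_eq_0 mult.commute)
  hence b4: "bernoulli 4 = - 1 / 30" .
  have "bernoulli 5 / fact 5 = 0 / fact 5"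
    using rec[of 5] by (simp add: atMost_nat_numeral atMost_Suc fact_numeral add_eq_0_iff add_eq_0_iff2
        b0 b1 b2 b3 b4)
  hence b5: "bernoulli 5 = 0" by (simp only: divide_cancel_right fact_nonzero simp_thms)
  have "bernoulli 6 / fact 6 = 1 / 42 / fact 6"
    using rec[of 6] by (simp add: atMost_nat_numeral atMost_Suc fact_numeral add_eq_0_iff add_eq_0_iff2
        b0 b1 b2 b3 b4 b5)
  hence b6: "bernoulli 6 = 1 / 42" by (simp only: divide_cancel_right fact_nonzero simp_thms)
  show "bernoulli 0 = 1" "bernoulli 2 = 1 / 6" "bernoulli 4 = - 1 / 30" "bernoulli 6 = 1 / 42"
    by fact+
qed

lemma coth_coeff_0: "coth_coeff 0 = 1"
  by (simp add: coth_coeff_def bernoulli_values)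

text \<open>
  The power series of \<open>w coth w\<close> in \<open>v = w\<^sup>2\<close> and the partial fraction series describe the same function near
  \<open>0\<close>. The proof strips off one coefficient at a time: if the series shifted by \<open>n + 1\<close> agrees with
  \<open>coth_tail n\<close> on \<open>(0, 1)\<close>, then the limits at \<open>0\<close> agree, which is the claim for \<open>n\<close>; subtracting
  the common limit and dividing by \<open>x\<close> gives the agreement for \<open>n + 1\<close>.
\<close>
lemma coth_coeff_eq: "coth_coeff (Suc n) = of_real (coth_tail n 0)"
proof -
  \<comment> \<open>The series converges for \<open>norm v < \<pi>\<^sup>2\<close>; the unit disc is all that the limit at \<open>0\<close> needs.\<close>
  define f where "f = (\<lambda>n v. (\<Sum>k. coth_coeff (k + Suc n) * v ^ k))"
  have summ0: "summable (\<lambda>k. coth_coeff k * v ^ k)" if "norm v < 1" for v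
  proof (cases "v = 0")
    case False
    have "norm (csqrt v) < 1" using that by (simp add: norm_csqrt real_sqrt_lt_1_iff)
    hence "norm (csqrt v) < pi" using pi_gt3 by linarith
    from coth_power_series[OF _ this] False show ?thesis
      by (simp add: coth_coeff_def sums_iff)
  qed simp
  have summ: "summable (\<lambda>k. coth_coeff (k + m) * v ^ k)" if "norm v < 1" for v m
  proof (cases "v = 0")
    case False
    have "summable (\<lambda>k. coth_coeff (k + m) * v ^ (k + m))"
      using summ0[OF that] by (subst summable_iff_shift)
    hence "summable (\<lambda>k. v ^ m * (coth_coeff (k + m) * v ^ k))" by (simp add: power_add mult_ac)
    thus ?thesis using False by (subst (asm) summable_cmult_iff) auto
  qed simp
  have lim: "(f n \<longlongrightarrow> coth_coeff (Suc n)) (at 0)" for n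
    using powser_limit_0[of 1 "\<lambda>k. coth_coeff (k + Suc n)" "f n"] summable_sums[OF summ[of _ "Suc n"]]
    unfolding f_def by simp
  have f_Suc: "f n v = coth_coeff (Suc n) + v * f (Suc n) v" if "norm v < 1" for n v
    using suminf_split_head[OF summ[OF that, of "Suc n"]] suminf_mult[OF summ[OF that, of "Suc (Suc n)"], of v]
    by (simp add: f_def algebra_simps)
  have ev: "eventually (\<lambda>x::real. x \<in> {0<..<1}) (at_right 0)"
    by (intro eventually_at_right_real) simp
  have step: "coth_coeff (Suc n) = of_real (coth_tail n 0)"
    if eq: "\<And>x. x \<in> {0<..<1} \<Longrightarrow> f n (of_real x) = of_real (coth_tail n x)" for n
  proof -
    have "((\<lambda>x. f n (of_real x)) \<longlongrightarrow> coth_coeff (Suc n)) (at_right 0)"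
      by (rule filterlim_compose[OF lim]) (auto simp: filterlim_at intro!: tendsto_eq_intros eventually_at_right_less[THEN eventually_mono])
    hence 1: "((\<lambda>x. complex_of_real (coth_tail n x)) \<longlongrightarrow> coth_coeff (Suc n)) (at_right 0)"
      by (rule Lim_transform_eventually) (use ev in \<open>auto elim!: eventually_mono simp: eq\<close>)
    have "((\<lambda>x. coth_tail n x - coth_tail n 0) \<longlongrightarrow> 0) (at_right 0)"
    proof (rule Lim_null_comparison)
      show "eventually (\<lambda>x. norm (coth_tail n x - coth_tail n 0) \<le> x * (pi ^ 2 / 6)) (at_right 0)"
        using ev
      proof eventually_elim
        case (elim x)
        thus ?case using coth_tail_Suc[of x n] abs_coth_tail_le[of x "Suc n"]
          by (simp add: abs_mult del: times_divide_eq_right)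
      qed
      show "((\<lambda>x. x * (pi ^ 2 / 6)) \<longlongrightarrow> 0) (at_right (0::real))"
        by (auto intro!: tendsto_eq_intros)
    qed
    hence "(coth_tail n \<longlongrightarrow> coth_tail n 0) (at_right 0)"
      by (rule Lim_null[THEN iffD2])
    hence "((\<lambda>x. complex_of_real (coth_tail n x)) \<longlongrightarrow> of_real (coth_tail n 0)) (at_right 0)"
      by (rule tendsto_of_real)
    with 1 show ?thesis by (intro tendsto_unique) auto
  qed
  have "\<forall>x\<in>{0<..<1}. f n (of_real x) = of_real (coth_tail n x)" for n
  proof (induction n)
    case 0
    show ?case
    proof
      fix x :: real assume x: "x \<in> {0<..<1}"
      define s where "s = sqrt x"
      have s: "s > 0" "s < 1" "s ^ 2 = x" using x by (auto simp: s_def)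
      have "(\<lambda>k. coth_coeff k * of_real x ^ k) sums (of_real s * coth (of_real s))"
        using coth_power_series[of "of_real s"] s pi_gt3 by (simp add: coth_coeff_def flip: of_real_power)
      also have "of_real s * coth (of_real s) = 1 + complex_of_real (x * coth_tail 0 x)"
        unfolding s(3)[symmetric] using s(1) coth_eq_coth_tail[OF s(1)]
        by (simp add: field_simps power2_eq_square)
      finally have "(\<Sum>k. coth_coeff k * of_real x ^ k) = 1 + complex_of_real (x * coth_tail 0 x)"
        by (simp add: sums_iff)
      moreover have "(\<Sum>k. coth_coeff k * of_real x ^ k) = 1 + of_real x * f 0 (of_real x)"
        using x suminf_split_head[OF summ0[of "of_real x"]] suminf_mult[OF summ[of "of_real x" 1], of "of_real x"]
        by (simp add: f_def coth_coeff_0 algebra_simps)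
      ultimately show "f 0 (of_real x) = of_real (coth_tail 0 x)" using x by simp
    qed
  next
    case (Suc n)
    hence *: "coth_coeff (Suc n) = of_real (coth_tail n 0)" by (intro step) auto
    show ?case
    proof
      fix x :: real assume x: "x \<in> {0<..<1}"
      have "coth_coeff (Suc n) + of_real x * f (Suc n) (of_real x) =
            of_real (coth_tail n 0 + x * coth_tail (Suc n) x)"
        using x Suc f_Suc[of "of_real x" n] coth_tail_Suc[of x n] by simp
      thus "f (Suc n) (of_real x) = of_real (coth_tail (Suc n) x)"
        using x unfolding * by simp
    qed
  qed
  thus ?thesis by (intro step) auto
qed

lemma coth_minus_coth_n:
  assumes "s > 0"
  shows "coth (of_real s) - coth_n n (of_real s) = of_real (s ^ (2 * n + 1) * coth_tail n (s ^ 2))"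
proof (induction n)
  case 0
  show ?case using coth_eq_coth_tail[OF assms] by (simp add: coth_n_def)
next
  case (Suc n)
  have "coth_n (Suc n) (of_real s) = coth_n n (of_real s) + coth_coeff (Suc n) * of_real s ^ (2 * n + 1)"
    by (simp add: coth_n_def coth_coeff_def)
  hence "coth (of_real s) - coth_n (Suc n) (of_real s) =
          of_real (s ^ (2 * n + 1) * (coth_tail n (s ^ 2) - coth_tail n 0))"
    using Suc.IH coth_coeff_eq[of n] by (simp add: algebra_simps)
  also have "coth_tail n (s ^ 2) - coth_tail n 0 = s ^ 2 * coth_tail (Suc n) (s ^ 2)"
    using coth_tail_Suc[of "s ^ 2" n] by simp
  finally show ?case by (simp add: power_add power2_eq_square mult_ac)
qed

section \<open>Integral representation of the zeta function\<close>

lemma of_real_square_powr: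
  assumes "s > 0"
  shows "complex_of_real (s ^ 2) powr y = of_real s powr (2 * y)"
proof -
  have "s ^ 2 \<noteq> 0" "s \<noteq> 0" "s ^ 2 > 0" using assms by auto
  thus ?thesis
    using Ln_of_real[of "s ^ 2"] Ln_of_real[of s] ln_realpow[of s 2] assms
    by (simp add: powr_def mult_ac del: of_real_power)
qed

text \<open>
  The factors of \<open>(-1)\<^sup>n\<close> and the powers \<open>a\<^sup>2\<^sup>n\<close> cancel, so the value does not depend on \<open>n\<close>;
  only the strip in which the integral converges does.
\<close>
lemma coth_term_integral:
  fixes z :: complex and a :: real
  assumes z: "2 * real n < Re z" "Re z < 2 * real n + 2" and a: "a > 0"
  defines "f \<equiv> \<lambda>s. complex_of_real s powr (- z) * of_real (s ^ (2 * n + 1) * ((-1) ^ n * 2 / (a ^ (2 * n) * (s ^ 2 + a ^ 2))))"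
  shows "set_integrable lborel {0<..} f"
    and "(LBINT s:{0<..}. f s) = of_real a powr (- z) * (of_real pi / sin (of_real pi * z / 2))"
proof -
  \<comment> \<open>With \<open>x = s\<^sup>2\<close> and \<open>dx = 2s ds\<close>, the exponents match when \<open>2(w - 1) = 2n - z\<close>.\<close>
  define w where "w = of_nat n + 1 - z / 2"
  have w: "0 < Re w" "Re w < 1" using z by (auto simp: w_def)
  define g where "g = (\<lambda>x. complex_of_real x powr (w - 1) / of_real (x + a ^ 2))"
  define C where "C = complex_of_real ((-1) ^ n / a ^ (2 * n))"
  have C: "C \<noteq> 0" using a by (simp add: C_def)
  have g: "set_integrable lborel {0<..} g" "(LBINT x:{0<..}. g x) =
     of_real (a ^ 2) powr (w - 1) * (of_real pi / sin (of_real pi * w))"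
    using Mellin_transform_of_inverse_shift[OF w, of "a ^ 2"] a by (simp_all add: g_def)
  have cg: "continuous_on {0<..} g"
    unfolding g_def using a
    by (intro continuous_intros) (auto simp: add_pos_pos less_imp_neq[symmetric] simp flip: of_real_power of_real_add)
  have "bij_betw (\<lambda>s::real. s ^ 2) {0<..} {0<..}"
    by (rule bij_betw_byWitness[of _ sqrt]) auto
  note sub = set_integral_substitution_Ioi[OF this _ _ _ cg g(1), of "\<lambda>s. 2 * s"]
  have power: "complex_of_real (s ^ 2) powr (w - 1) = of_real s ^ (2 * n) * of_real s powr (- z)" if "s > 0" for s
  proof -
    have "complex_of_real (s ^ 2) powr (w - 1) = of_real s powr (of_nat (2 * n) + - z)"
      unfolding of_real_square_powr[OF that] by (simp add: w_def algebra_simps)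
    also have "\<dots> = of_real s ^ (2 * n) * of_real s powr (- z)"
      using that powr_complexpow[of "of_real s" "2 * n"] by (simp only: powr_add) simp
    finally show ?thesis .
  qed
  have eq: "f s = C * ((2 * s) *\<^sub>R g (s ^ 2))" if "s > 0" for s
  proof -
    from power[OF that] show ?thesis
      by (simp add: f_def g_def C_def scaleR_conv_of_real mult_ac)
  qed
  have "set_integrable lborel {0<..} (\<lambda>s. C * ((2 * s) *\<^sub>R g (s ^ 2)))"
    by (intro set_integrable_mult_right sub) (auto intro!: derivative_eq_intros continuous_intros)
  thus "set_integrable lborel {0<..} f"
    by (subst set_integrable_cong[OF refl refl eq]) auto
  have "(LBINT s:{0<..}. f s) = (LBINT s:{0<..}. C * ((2 * s) *\<^sub>R g (s ^ 2)))"
    by (intro set_lebesgue_integral_cong) (auto simp: eq)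
  also have "\<dots> = C * (LBINT s:{0<..}. (2 * s) *\<^sub>R g (s ^ 2))"
    by (rule set_integral_mult_right)
  also have "(LBINT s:{0<..}. (2 * s) *\<^sub>R g (s ^ 2)) = (LBINT x:{0<..}. g x)"
    by (rule sub) (auto intro!: derivative_eq_intros continuous_intros)
  also have "\<dots> = of_real (a ^ 2) powr (w - 1) * (of_real pi / sin (of_real pi * w))"
    by (rule g)
  also have "complex_of_real (a ^ 2) powr (w - 1) = of_real a ^ (2 * n) * of_real a powr (- z)"
    by (rule power[OF a])
  also have "sin (of_real pi * w) = (-1) ^ n * sin (of_real pi * z / 2)"
  proof -
    have "sin (of_real pi * w) = sin (of_real pi - (of_real pi * z / 2 - of_real (of_nat n * pi)))"
      by (simp add: w_def algebra_simps)
    also have "\<dots> = sin (of_real pi * z / 2 - of_real (of_nat n * pi))"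
      by (simp add: sin_diff sin_of_real cos_of_real)
    also have "\<dots> = (-1) ^ n * sin (of_real pi * z / 2)"
      by (simp only: sin_diff sin_of_real cos_of_real sin_npi cos_npi) simp
    finally show ?thesis .
  qed
  also have "C * (of_real a ^ (2 * n) * of_real a powr (- z) * (of_real pi / ((-1) ^ n * sin (of_real pi * z / 2)))) =
             of_real a powr (- z) * (of_real pi / sin (of_real pi * z / 2))"
    using a by (simp add: C_def field_simps flip: power_add power_mult_distrib)
  finally show "(LBINT s:{0<..}. f s) = of_real a powr (- z) * (of_real pi / sin (of_real pi * z / 2))" .
qed

lemma zeta_integral:
  fixes z :: complex
  assumes z: "max 1 (2 * real n) < Re z" "Re z < 2 * real n + 2"
  shows "set_integrable lborel {0<..} (\<lambda>s. of_real s powr (- z) * (coth (of_real s) - coth_n n (of_real s)))"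
    and "zeta z = sin (of_real pi * z / 2) * of_real pi powr (z - 1) *
            (LBINT s:{0<..}. of_real s powr (- z) * (coth (of_real s) - coth_n n (of_real s)))"
proof -
  define a where "a = (\<lambda>k. pi * Suc k)"
  have a: "a k > 0" for k by (simp add: a_def)
  define R where "R = (\<lambda>k s. s ^ (2 * n + 1) * ((-1) ^ n * 2 / (a k ^ (2 * n) * (s ^ 2 + a k ^ 2))))"
  define f where "f = (\<lambda>k s. indicator {0<..} s *\<^sub>R (complex_of_real s powr (- z) * of_real (R k s)))"
  define \<sigma> where "\<sigma> = complex_of_real pi / sin (of_real pi * z / 2)"
  have intf: "integrable lborel (f k)" "(\<integral>s. f k s \<partial>lborel) = of_real (a k) powr (- z) * \<sigma>" for k
    using coth_term_integral[of n z "a k"] z a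
    by (simp_all add: f_def set_integrable_def set_lebesgue_integral_def R_def \<sigma>_def)
  have sums: "(\<lambda>k. R k s) sums (s ^ (2 * n + 1) * coth_tail n (s ^ 2))" for s
    unfolding R_def a_def by (intro sums_mult coth_tail_sums) simp
  have f_sums: "(\<lambda>k. f k s) sums (indicator {0<..} s *\<^sub>R (of_real s powr (- z) * (coth (of_real s) - coth_n n (of_real s))))" for s
  proof (cases "s > 0")
    case True
    show ?thesis unfolding f_def coth_minus_coth_n[OF True]
      by (intro sums_scaleR_right sums_mult sums_of_real sums)
  qed (simp add: f_def)
  \<comment> \<open>The summands have the constant sign \<open>(-1)\<^sup>n\<close>, so their norms are summands of the same kind
    with \<open>Re z\<close> in place of \<open>z\<close>.\<close>
  have norm_f: "norm (f k s) = indicator {0<..} s * (s powr (- Re z) * ((-1) ^ n * R k s))" for k s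
  proof (cases "s > 0")
    case True
    have "(-1) ^ n * R k s = s ^ (2 * n + 1) * (2 / (a k ^ (2 * n) * (s ^ 2 + a k ^ 2)))"
      by (simp add: R_def flip: power_add power_mult_distrib)
    also have "\<dots> \<ge> 0" using True a[of k] by simp
    finally have "\<bar>R k s\<bar> = (-1) ^ n * R k s"
      by (cases "even n") auto
    thus ?thesis using True by (simp add: f_def norm_mult norm_powr_real_powr)
  qed (simp add: f_def)
  have real_powr: "complex_of_real s powr (- of_real (Re z)) = of_real (s powr (- Re z))" if "s > 0" for s
    using powr_of_real[of s "- Re z"] that by simp
  have summable_norm: "summable (\<lambda>k. norm (f k s))" for s
    unfolding norm_f using sums by (intro summable_mult) (auto simp: sums_iff)
  have norm_int: "complex_of_real (\<integral>s. norm (f k s) \<partial>lborel) =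
      of_real (a k powr (- Re z)) * ((-1) ^ n * (of_real pi / sin (of_real pi * of_real (Re z) / 2)))" for k
  proof -
    have "complex_of_real (\<integral>s. norm (f k s) \<partial>lborel) = (\<integral>s. complex_of_real (norm (f k s)) \<partial>lborel)"
      by (rule integral_complex_of_real[symmetric])
    also have "\<dots> = (\<integral>s. (-1) ^ n * (indicator {0<..} s *\<^sub>R (complex_of_real s powr (- of_real (Re z)) * of_real (R k s))) \<partial>lborel)"
      unfolding norm_f
      by (intro Bochner_Integration.integral_cong)
         (auto simp: indicator_def real_powr mult_ac)
    also have "\<dots> = (-1) ^ n * (\<integral>s. indicator {0<..} s *\<^sub>R (complex_of_real s powr (- of_real (Re z)) * of_real (R k s)) \<partial>lborel)"
      by (rule integral_mult_right_zero)
    also have "\<dots> = (-1) ^ n * (of_real (a k) powr (- of_real (Re z)) * (of_real pi / sin (of_real pi * of_real (Re z) / 2)))"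
      using coth_term_integral(2)[of n "of_real (Re z)" "a k"] z a
      by (simp add: set_lebesgue_integral_def R_def)
    finally show ?thesis using a[of k] by (simp add: real_powr mult_ac)
  qed
  have summable_int: "summable (\<lambda>k. \<integral>s. norm (f k s) \<partial>lborel)"
  proof -
    have "summable (\<lambda>k. real (Suc k) powr (- Re z))"
      using z summable_real_powr_iff[of "- Re z"] by (subst summable_Suc_iff) auto
    hence "summable (\<lambda>k. pi powr (- Re z) * real (Suc k) powr (- Re z))"
      by (rule summable_mult)
    hence "summable (\<lambda>k. a k powr (- Re z))"
      by (simp add: a_def powr_mult del: of_nat_Suc)
    hence "summable (\<lambda>k. complex_of_real (\<integral>s. norm (f k s) \<partial>lborel))"
      unfolding norm_int by (intro summable_mult2 summable_of_real)
    thus ?thesis by (simp only: summable_complex_of_real)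
  qed
  have AE: "AE s in lborel. summable (\<lambda>k. norm (f k s))"
    using summable_norm by simp
  have suminf_f: "(\<lambda>s. \<Sum>k. f k s) = (\<lambda>s. indicator {0<..} s *\<^sub>R (of_real s powr (- z) * (coth (of_real s) - coth_n n (of_real s))))"
    using f_sums by (simp add: sums_iff fun_eq_iff)
  show "set_integrable lborel {0<..} (\<lambda>s. of_real s powr (- z) * (coth (of_real s) - coth_n n (of_real s)))"
    using integrable_suminf[OF intf(1) AE summable_int]
    unfolding suminf_f set_integrable_def .
  define I where "I = (LBINT s:{0<..}. of_real s powr (- z) * (coth (of_real s) - coth_n n (of_real s)))"
  have I: "(\<lambda>k. of_real (a k) powr (- z) * \<sigma>) sums I"
    using sums_integral[OF intf(1) AE summable_int]
    unfolding suminf_f I_def set_lebesgue_integral_def intf(2) .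
  \<comment> \<open>The zeros of \<open>sin (\<pi>z/2)\<close> are the even integers, none of which lies strictly between \<open>2n\<close> and \<open>2n + 2\<close>.\<close>
  have sin_nz: "sin (of_real pi * z / 2) \<noteq> 0"
  proof
    assume "sin (of_real pi * z / 2) = 0"
    then obtain m :: int where "of_real pi * z / 2 = of_real (of_int m * pi)"
      by (auto simp: sin_eq_0)
    hence "z = of_int (2 * m)" by (simp add: field_simps)
    hence "Re z = of_int (2 * m)" by simp
    with z have "int n < m" "m < int n + 1" by auto
    thus False by linarith
  qed
  have "(\<lambda>k. sin (of_real pi * z / 2) * of_real pi powr (z - 1) * (of_real (a k) powr (- z) * \<sigma>)) sums
          (sin (of_real pi * z / 2) * of_real pi powr (z - 1) * I)"
    using I by (rule sums_mult)
  also have "(\<lambda>k. sin (of_real pi * z / 2) * of_real pi powr (z - 1) * (of_real (a k) powr (- z) * \<sigma>)) =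
             (\<lambda>k. of_nat (Suc k) powr (- z))"
  proof
    fix k
    have "of_real (a k) powr (- z) = of_real pi powr (- z) * complex_of_real (real (Suc k)) powr (- z)"
      unfolding a_def of_real_mult by (intro powr_times_real) auto
    moreover have "of_real pi powr (z - 1) * of_real pi powr (- z) * complex_of_real pi = 1"
      by (simp add: powr_diff powr_minus)
    ultimately show "sin (of_real pi * z / 2) * of_real pi powr (z - 1) * (of_real (a k) powr (- z) * \<sigma>) =
                     of_nat (Suc k) powr (- z)"
      using sin_nz by (simp add: \<sigma>_def field_simps del: of_nat_Suc)
  qed
  finally show "zeta z = sin (of_real pi * z / 2) * of_real pi powr (z - 1) * I"
    unfolding zeta_def by (rule sums_unique[symmetric])
qed

lemma sin_odd_multiple: "sin (complex_of_real pi * (2 * of_nat n + 1) / 2) = (-1) ^ n"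
proof -
  have "complex_of_real pi * (2 * of_nat n + 1) / 2 = of_real (of_nat n * pi) + of_real (pi / 2)"
    by (simp add: field_simps)
  thus ?thesis
    by (simp only: sin_add sin_of_real cos_of_real sin_npi cos_npi sin_pi_half cos_pi_half) simp
qed

lemma zeta_odd_integral:
  assumes "n > 0"
  shows "zeta (2 * of_nat n + 1) = (-1) ^ n * of_real pi ^ (2 * n) *
            (LBINT s:{0<..}. of_real s powr (- (2 * of_nat n + 1)) * (coth (of_real s) - coth_n n (of_real s)))"
proof -
  have "complex_of_real pi powr (2 * of_nat n + 1 - 1) = of_real pi powr (of_nat (2 * n))" by simp
  also have "\<dots> = of_real pi ^ (2 * n)" by (rule powr_complexpow) simp
  finally show ?thesis
    using zeta_integral(2)[of n "2 * of_nat n + 1"] assms unfolding sin_odd_multiple by simp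
qed

lemma coth_n_values:
  "coth_n 1 s = 1 / s + s / 3"
  "coth_n 2 s = 1 / s + s / 3 - s ^ 3 / 45"
  "coth_n 3 s = 1 / s + s / 3 - s ^ 3 / 45 + 2 * s ^ 5 / 945"
proof -
  show 1: "coth_n 1 s = 1 / s + s / 3"
    by (simp add: coth_n_def bernoulli_values)
  have "coth_n 2 s = coth_n 1 s + 2 ^ 4 * bernoulli 4 / fact 4 * s ^ 3"
    by (simp add: coth_n_def numeral_eq_Suc)
  thus 2: "coth_n 2 s = 1 / s + s / 3 - s ^ 3 / 45"
    unfolding 1 by (simp add: bernoulli_values fact_numeral)
  have "coth_n 3 s = coth_n 2 s + 2 ^ 6 * bernoulli 6 / fact 6 * s ^ 5"
    by (simp add: coth_n_def numeral_eq_Suc)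
  thus "coth_n 3 s = 1 / s + s / 3 - s ^ 3 / 45 + 2 * s ^ 5 / 945"
    unfolding 2 by (simp add: bernoulli_values fact_numeral)
qed

theorem theorem2p9:
  shows "(\<forall>(n::nat) (z::complex).
            max 1 (2 * real n) < Re z \<and> Re z < 2 * real n + 2 \<longrightarrow>
              set_integrable lborel {0::real<..}
                (\<lambda>s. of_real s powr (- z) * (coth (of_real s) - coth_n n (of_real s))) \<and>
              zeta z = sin (of_real pi * z / 2) * of_real pi powr (z - 1) *
                (LBINT s:{0<..}. of_real s powr (- z) * (coth (of_real s) - coth_n n (of_real s))))
       \<and> zeta 3 = - (of_real pi ^ 2) *
            (LBINT s:{0<..}. of_real s powr (- 3) * (coth (of_real s) - coth_n 1 (of_real s)))
       \<and> zeta 3 = - (of_real pi ^ 2) *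
            (LBINT s:{0<..}. of_real s powr (- 3) *
               (coth (of_real s) - 1 / of_real s - of_real s / 3))
       \<and> zeta 5 = of_real pi ^ 4 *
            (LBINT s:{0<..}. of_real s powr (- 5) * (coth (of_real s) - coth_n 2 (of_real s)))
       \<and> zeta 5 = of_real pi ^ 4 *
            (LBINT s:{0<..}. of_real s powr (- 5) *
               (coth (of_real s) - 1 / of_real s - of_real s / 3 + of_real s ^ 3 / 45))
       \<and> zeta 7 = - (of_real pi ^ 6) *
            (LBINT s:{0<..}. of_real s powr (- 7) * (coth (of_real s) - coth_n 3 (of_real s)))
       \<and> zeta 7 = - (of_real pi ^ 6) *
            (LBINT s:{0<..}. of_real s powr (- 7) *
               (coth (of_real s) - 1 / of_real s - of_real s / 3 + of_real s ^ 3 / 45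
                 - 2 * of_real s ^ 5 / 945))"
proof -
  have z3: "zeta 3 = - (of_real pi ^ 2) *
            (LBINT s:{0<..}. of_real s powr (- 3) * (coth (of_real s) - coth_n 1 (of_real s)))"
    using zeta_odd_integral[of 1] by simp
  have z5: "zeta 5 = of_real pi ^ 4 *
            (LBINT s:{0<..}. of_real s powr (- 5) * (coth (of_real s) - coth_n 2 (of_real s)))"
    using zeta_odd_integral[of 2] by simp
  have z7: "zeta 7 = - (of_real pi ^ 6) *
            (LBINT s:{0<..}. of_real s powr (- 7) * (coth (of_real s) - coth_n 3 (of_real s)))"
    using zeta_odd_integral[of 3] by simp
  have diff: "c - coth_n 1 s = c - 1 / s - s / 3"
    "c - coth_n 2 s = c - 1 / s - s / 3 + s ^ 3 / 45"
    "c - coth_n 3 s = c - 1 / s - s / 3 + s ^ 3 / 45 - 2 * s ^ 5 / 945" for c s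
    unfolding coth_n_values by simp_all
  show ?thesis
    using z3 z5 z7 z3[unfolded diff] z5[unfolded diff] z7[unfolded diff] zeta_integral
    by (intro conjI allI impI) auto
qed

end
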